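(* Let $c$ be a structured-decomposable tensorized circuit over a finite set of variables $\mathbf{X}$. If $c$ is orthonormal, then its squaring encodes a normalized distribution, i.e., $$Z=\int_{\mathrm{dom}(\mathbf{X})}|c(\mathbf{x})|^2\,\mathrm{d}\mathbf{x}=1 .$$
   Context: Variables: $\mathbf{X}=\{X_i\}_{i=1}^d$ is a finite set of variables, each with a domain $\mathrm{dom}(X_i)$, and $\mathrm{dom}(\mathbf{X})$ is the product of the domains. Integrals over the domain of a continuous variable are with respect to Lebesgue measure; for discrete variables they are sums (counting measure). $[n]=\{1,\dots,n\}$; $(\cdot)^*$ is complex conjugation; $(\cdot)^\dagger$ is the conjugate transpose; $\mathbf{I}_n$ is the $n\times n$ identity matrix; $\delta_{ij}$ is the Kronecker delta. Tensorized circuit: a tensorized circuit $c$ over $\mathbf{X}$ is a parameterized (finite, acyclic) computational graph encoding a function $c(\mathbf{X})$ and comprising three kinds of layers: input, product and sum. A layer $\ell$ is a vector-valued function of a set of variables $\mathrm{sc}(\ell)\subseteq\mathbf{X}$, called its scope. Every non-input layer receives the outputs of other layers as inputs, and its scope is the union of the scopes of its inputs. - Each input layer has scope a single variable $X\in\mathbf{X}$ and computes a vector of $K$ functions $f_1,\dots,f_K:\mathrm{dom}(X)\to\mathbb{C}$. - Each product layer computes either the element-wise (Hadamard) product $\odot_{i=1}^N\ell_i(\mathrm{sc}(\ell_i))$ or the Kronecker product $\otimes_{i=1}^N\ell_i(\mathrm{sc}(\ell_i))$ of the output vectors of its $N$ inputs $\ell_1,\dots,\ell_N$. - Each sum layer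 has exactly one input $\ell_1$, is parameterized by a matrix $\mathbf{W}\in\mathbb{C}^{K_1\times K_2}$, and computes $\mathbf{W}\,\ell_1(\mathrm{sc}(\ell_1))$. The circuit has a single output layer, with scope $\mathbf{X}$ and a one-dimensional (scalar) output; this output is $c(\mathbf{x})\in\mathbb{C}$. Decomposable: for every product layer, distinct inputs have disjoint scopes. Structured-decomposable: decomposable and, moreover, each product layer factorizes its scope into the scopes of its inputs in such a way that the collection of all these factorizations (over all product layers) forms a tree of subsets of $\mathbf{X}$. Squaring: the squaring of $c$ is the function $c^2(\mathbf{x})=|c(\mathbf{x})|^2=c(\mathbf{x})c(\mathbf{x})^*$, which encodes the distribution $p(\mathbf{x})=Z^{-1}|c(\mathbf{x})|^2$ with $Z=\int_{\mathrm{dom}(\mathbf{X})}|c(\mathbf{x})|^2\,\mathrm{d}\mathbf{x}$. Orthonormal circuit: a tensorized circuit is orthonormal if (1) each input layer, over a variable $X$, encodes a vector $[f_1(X),\dots,f_K(X)]^\top$ of orthonormal functions, i.e., $\int_{\mathrm{dom}(X)}f_i(x)f_j(x)^*\,\mathrm{d}x=\delta_{ij}$ for all $i,j\in[K]$; and (2) each sum layer is parameterized by a (semi-)unitary matrix $\mathbf{W}\in\mathbb{C}^{K_1\times K_2}$ with $K_1\le K_2$, i.e., $\mathbf{W}\mathbf{W}^\dagger=\mathbf{I}_{K_1}$. *)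

theory Defs
  imports "HOL-Analysis.Analysis" "Jordan_Normal_Form.Schur_Decomposition"
begin

unbundle no vec_syntax

section \<open>Variables and their domains\<close>

datatype ('e, 'd) var_domain = Continuous "'e set" | Discrete "'d set"

text \<open>Variables may have domains of both kinds, so values live in the sum type \<open>'e + 'd\<close>:
  a continuous value is tagged with \<open>Inl\<close>, a discrete one with \<open>Inr\<close>.\<close>

fun valid_domain :: "('e :: euclidean_space, 'd) var_domain \<Rightarrow> bool" where
  "valid_domain (Continuous D) \<longleftrightarrow> D \<in> sets lebesgue"
| "valid_domain (Discrete D) \<longleftrightarrow> countable D"

fun base_measure :: "('e :: euclidean_space, 'd) var_domain \<Rightarrow> ('e + 'd) measure" where
  "base_measure (Continuous D) = embed_measure (lebesgue_on D) Inl"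
| "base_measure (Discrete D) = count_space (Inr ` D)"

section \<open>Tensorized circuits\<close>

text \<open>\<open>'l\<close> is the type of layer names (nodes of the computational graph), \<open>'x\<close> the type of
  variables and \<open>'a\<close> the type of values. The vector of functions computed by an input layer is
  given as a list of functions; \<open>Sum W m\<close> has parameter matrix \<open>W\<close> and input \<open>m\<close>.\<close>

datatype ('l, 'x, 'a) layer =
    Input 'x "('a \<Rightarrow> complex) list"
  | Hadamard "'l list"
  | Kronecker "'l list"
  | Sum "complex mat" 'l

fun layer_inputs :: "('l, 'x, 'a) layer \<Rightarrow> 'l list" where
  "layer_inputs (Input X fs) = []"
| "layer_inputs (Hadamard ms) = ms"
| "layer_inputs (Kronecker ms) = ms"
| "layer_inputs (Sum W m) = [m]"

fun is_product :: "('l, 'x, 'a) layer \<Rightarrow> bool" where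
  "is_product (Hadamard ms) \<longleftrightarrow> True"
| "is_product (Kronecker ms) \<longleftrightarrow> True"
| "is_product _ \<longleftrightarrow> False"

record ('l, 'x, 'a) circuit =
  layers :: "'l set"
  layer_at :: "'l \<Rightarrow> ('l, 'x, 'a) layer"
  output_layer :: 'l

abbreviation inputs_of :: "('l, 'x, 'a) circuit \<Rightarrow> 'l \<Rightarrow> 'l list" where
  "inputs_of C l \<equiv> layer_inputs (layer_at C l)"

definition input_rel :: "('l, 'x, 'a) circuit \<Rightarrow> ('l \<times> 'l) set" where
  "input_rel C = {(m, l). l \<in> layers C \<and> m \<in> set (inputs_of C l)}"

definition circuit_graph :: "('l, 'x, 'a) circuit \<Rightarrow> bool" where
  "circuit_graph C \<longleftrightarrow>
     finite (layers C) \<and>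
     (\<forall>l\<in>layers C. set (inputs_of C l) \<subseteq> layers C) \<and>
     acyclic (input_rel C)"

text \<open>Bottom-up recursion over the (well-founded) computational graph; the intended recursion
  equation is the lemma \<open>circuit_rec_unfold\<close> below.\<close>

definition circuit_rec ::
  "(('l, 'x, 'a) layer \<Rightarrow> 'r list \<Rightarrow> 'r) \<Rightarrow> ('l, 'x, 'a) circuit \<Rightarrow> 'l \<Rightarrow> 'r" where
  "circuit_rec f C =
     wfrec (input_rel C) (\<lambda>rec l. f (layer_at C l) (map rec (inputs_of C l)))"

lemma finite_input_rel: "finite (layers C) \<Longrightarrow> finite (input_rel C)"
proof -
  assume "finite (layers C)"
  moreover have "input_rel C \<subseteq> (\<Union>l\<in>layers C. (\<lambda>m. (m, l)) ` set (inputs_of C l))"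
    by (auto simp: input_rel_def)
  ultimately show ?thesis
    by (meson finite_UN_I finite_imageI finite_set finite_subset)
qed

lemma wf_input_rel: "circuit_graph C \<Longrightarrow> wf (input_rel C)"
  by (simp add: circuit_graph_def finite_acyclic_wf finite_input_rel)

lemma circuit_rec_unfold:
  assumes "circuit_graph C" "l \<in> layers C"
  shows "circuit_rec f C l = f (layer_at C l) (map (circuit_rec f C) (inputs_of C l))"
proof -
  have "map (cut (circuit_rec f C) (input_rel C) l) (inputs_of C l)
      = map (circuit_rec f C) (inputs_of C l)"
    using assms(2) by (auto simp: cut_def input_rel_def)
  moreover have "circuit_rec f C l =
      f (layer_at C l) (map (cut (circuit_rec f C) (input_rel C) l) (inputs_of C l))"
    unfolding circuit_rec_def by (rule wfrec[OF wf_input_rel[OF assms(1)]])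
  ultimately show ?thesis
    by (simp only:)
qed

fun scope_step :: "('l, 'x, 'a) layer \<Rightarrow> 'x set list \<Rightarrow> 'x set" where
  "scope_step (Input X fs) Ss = {X}"
| "scope_step _ Ss = \<Union> (set Ss)"

definition scope :: "('l, 'x, 'a) circuit \<Rightarrow> 'l \<Rightarrow> 'x set" where
  "scope = circuit_rec scope_step"

text \<open>\<open>width C l\<close> is the dimension of the output vector of layer \<open>l\<close>.\<close>

fun width_step :: "('l, 'x, 'a) layer \<Rightarrow> nat list \<Rightarrow> nat" where
  "width_step (Input X fs) ks = length fs"
| "width_step (Hadamard ms) ks = hd ks"
| "width_step (Kronecker ms) ks = prod_list ks"
| "width_step (Sum W m) ks = dim_row W"

definition width :: "('l, 'x, 'a) circuit \<Rightarrow> 'l \<Rightarrow> nat" where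
  "width = circuit_rec width_step"

definition hadamard_prod :: "complex vec list \<Rightarrow> complex vec" where
  "hadamard_prod vs = vec (dim_vec (hd vs)) (\<lambda>i. \<Prod>v\<leftarrow>vs. v $ i)"

definition kron :: "complex vec \<Rightarrow> complex vec \<Rightarrow> complex vec" where
  "kron u v =
     vec (dim_vec u * dim_vec v) (\<lambda>i. u $ (i div dim_vec v) * v $ (i mod dim_vec v))"

definition kronecker_prod :: "complex vec list \<Rightarrow> complex vec" where
  "kronecker_prod vs = foldr kron vs (vec 1 (\<lambda>_. 1))"

fun value_step ::
  "('x \<Rightarrow> 'a) \<Rightarrow> ('l, 'x, 'a) layer \<Rightarrow> complex vec list \<Rightarrow> complex vec" where
  "value_step x (Input X fs) vs = vec (length fs) (\<lambda>i. (fs ! i) (x X))"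
| "value_step x (Hadamard ms) vs = hadamard_prod vs"
| "value_step x (Kronecker ms) vs = kronecker_prod vs"
| "value_step x (Sum W m) vs = W *\<^sub>v hd vs"

definition layer_value :: "('l, 'x, 'a) circuit \<Rightarrow> ('x \<Rightarrow> 'a) \<Rightarrow> 'l \<Rightarrow> complex vec" where
  "layer_value C x = circuit_rec (value_step x) C"

fun valid_layer :: "'x set \<Rightarrow> ('l, 'x, 'a) circuit \<Rightarrow> ('l, 'x, 'a) layer \<Rightarrow> bool" where
  "valid_layer V C (Input X fs) \<longleftrightarrow> X \<in> V"
| "valid_layer V C (Hadamard ms) \<longleftrightarrow>
     ms \<noteq> [] \<and> (\<forall>m\<in>set ms. \<forall>m'\<in>set ms. width C m = width C m')"
| "valid_layer V C (Kronecker ms) \<longleftrightarrow> ms \<noteq> []"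
| "valid_layer V C (Sum W m) \<longleftrightarrow> dim_col W = width C m"

text \<open>The third conjunct: the circuit has a single output layer.\<close>

definition tensorized_circuit :: "'x set \<Rightarrow> ('l, 'x, 'a) circuit \<Rightarrow> bool" where
  "tensorized_circuit V C \<longleftrightarrow>
     circuit_graph C \<and>
     (\<forall>l\<in>layers C. valid_layer V C (layer_at C l)) \<and>
     {l \<in> layers C. \<forall>m\<in>layers C. l \<notin> set (inputs_of C m)} = {output_layer C} \<and>
     scope C (output_layer C) = V \<and>
     width C (output_layer C) = 1"

definition circuit_fun :: "('l, 'x, 'a) circuit \<Rightarrow> ('x \<Rightarrow> 'a) \<Rightarrow> complex" where
  "circuit_fun C x = layer_value C x (output_layer C) $ 0"

section \<open>Structured decomposability\<close>

text \<open>Inputs of a product layer are distinguished by position, so a layer of nonempty scope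
  that is used twice violates decomposability.\<close>

definition decomposable :: "('l, 'x, 'a) circuit \<Rightarrow> bool" where
  "decomposable C \<longleftrightarrow>
     (\<forall>l\<in>layers C. is_product (layer_at C l) \<longrightarrow>
        (\<forall>i < length (inputs_of C l). \<forall>j < length (inputs_of C l). i \<noteq> j \<longrightarrow>
           scope C (inputs_of C l ! i) \<inter> scope C (inputs_of C l ! j) = {}))"

text \<open>Each factorization is a pair of a scope and the set of its parts. A product layer with a
  single input does not split its scope and contributes no factorization.\<close>

definition factorizations :: "('l, 'x, 'a) circuit \<Rightarrow> ('x set \<times> 'x set set) set" where
  "factorizations C =
     {(scope C l, scope C ` set (inputs_of C l)) | l.
        l \<in> layers C \<and> is_product (layer_at C l) \<and> 2 \<le> length (inputs_of C l)}"

text \<open>A collection of factorizations forms a tree of subsets of \<open>V\<close> if every set is factorized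
  in at most one way, and the relation between a set and its parts is a directed tree with root
  \<open>V\<close>: acyclic, at most one parent for every set, and every set reachable from \<open>V\<close>.\<close>

definition tree_of_subsets :: "'x set \<Rightarrow> ('x set \<times> 'x set set) set \<Rightarrow> bool" where
  "tree_of_subsets V F \<longleftrightarrow>
     single_valued F \<and>
     (let E = {(S, A). \<exists>P. (S, P) \<in> F \<and> A \<in> P} in
        Field E \<subseteq> Pow V \<and>
        acyclic E \<and>
        single_valued (E\<inverse>) \<and>
        (\<forall>S\<in>Field E. (V, S) \<in> E\<^sup>*))"

definition structured_decomposable :: "'x set \<Rightarrow> ('l, 'x, 'a) circuit \<Rightarrow> bool" where
  "structured_decomposable V C \<longleftrightarrow> decomposable C \<and> tree_of_subsets V (factorizations C)"

section \<open>Squaring and orthonormality\<close>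

definition squaring :: "('l, 'x, 'a) circuit \<Rightarrow> ('x \<Rightarrow> 'a) \<Rightarrow> real" where
  "squaring C x = (cmod (circuit_fun C x))\<^sup>2"

definition partition_function ::
  "'x set \<Rightarrow> ('x \<Rightarrow> ('e :: euclidean_space, 'd) var_domain) \<Rightarrow>
   ('l, 'x, 'e + 'd) circuit \<Rightarrow> real" where
  "partition_function V dm C = (\<integral>x. squaring C x \<partial>(\<Pi>\<^sub>M X\<in>V. base_measure (dm X)))"

text \<open>The Bochner integral of a function that is not integrable is 0 by convention. Using
  \<open>has_bochner_integral\<close> makes the existence of the integrals part of orthonormality.\<close>

definition orthonormal_functions :: "'a measure \<Rightarrow> ('a \<Rightarrow> complex) list \<Rightarrow> bool" where
  "orthonormal_functions M fs \<longleftrightarrow>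
     (\<forall>i < length fs. \<forall>j < length fs.
        has_bochner_integral M (\<lambda>x. (fs ! i) x * cnj ((fs ! j) x)) (if i = j then 1 else 0))"

definition semi_unitary :: "complex mat \<Rightarrow> bool" where
  "semi_unitary W \<longleftrightarrow> dim_row W \<le> dim_col W \<and> W * mat_adjoint W = 1\<^sub>m (dim_row W)"

definition orthonormal_circuit ::
  "('x \<Rightarrow> ('e :: euclidean_space, 'd) var_domain) \<Rightarrow> ('l, 'x, 'e + 'd) circuit \<Rightarrow> bool" where
  "orthonormal_circuit dm C \<longleftrightarrow>
     (\<forall>l\<in>layers C. \<forall>X fs. layer_at C l = Input X fs \<longrightarrow>
        orthonormal_functions (base_measure (dm X)) fs) \<and>
     (\<forall>l\<in>layers C. \<forall>W m. layer_at C l = Sum W m \<longrightarrow> semi_unitary W)"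

end

theory Submission
  imports Defs
begin

text \<open>By induction along the computational graph, the Gram matrix of the component functions of
  every layer, integrated over the scope of that layer, is the identity. For product layers this is
  Fubini's theorem, since the scopes of the inputs are disjoint; a sum layer turns a Gram matrix
  \<open>G\<close> into \<open>W G W\<^sup>\<dagger>\<close>. At the scalar output layer the only Gram entry is \<open>Z\<close>.\<close>

section \<open>Functions of a subset of the variables\<close>

text \<open>Layer values are functions of total assignments, while \<open>PiM S M\<close> lives on
  assignments that are undefined outside \<open>S\<close>. This predicate lets one function be
  integrated over every \<open>PiM T M\<close> with \<open>T\<close> containing its scope.\<close>

definition depends_on :: "'i set \<Rightarrow> (('i \<Rightarrow> 'a) \<Rightarrow> 'b) \<Rightarrow> bool" where
  "depends_on S f \<longleftrightarrow> (\<forall>x y. (\<forall>X\<in>S. x X = y X) \<longrightarrow> f x = f y)"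

lemma depends_onD: "depends_on S f \<Longrightarrow> (\<And>X. X \<in> S \<Longrightarrow> x X = y X) \<Longrightarrow> f x = f y"
  by (auto simp: depends_on_def)

lemma depends_on_comp: "depends_on S f \<Longrightarrow> depends_on S (\<lambda>x. h (f x))"
  unfolding depends_on_def by metis

lemma depends_on_comp2:
  assumes "depends_on S f" "depends_on T g"
  shows "depends_on (S \<union> T) (\<lambda>x. h (f x) (g x))"
  unfolding depends_on_def
proof (intro allI impI)
  fix x y :: "'a \<Rightarrow> 'b" assume "\<forall>X\<in>S \<union> T. x X = y X"
  then have "f x = f y" "g x = g y"
    using depends_onD[OF assms(1), of x y] depends_onD[OF assms(2), of x y] by simp_all
  then show "h (f x) (g x) = h (f y) (g y)" by simp
qed

lemma depends_on_map:
  assumes "\<And>m. m \<in> set ms \<Longrightarrow> depends_on (S m) (v m)"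
  shows "depends_on (\<Union> (S ` set ms)) (\<lambda>x. map (\<lambda>m. v m x) ms)"
  using assms unfolding depends_on_def by (auto intro!: map_cong)

text \<open>Restricting an assignment to \<open>S\<close> is measurable from the larger product to
  the smaller one and leaves the value of \<open>f\<close> unchanged.\<close>

lemma measurable_depends_on:
  assumes f: "f \<in> measurable (PiM S M) N" and dep: "depends_on S f" and sub: "S \<subseteq> T"
  shows "f \<in> measurable (PiM T M) N"
proof -
  have "(\<lambda>x. f (restrict x S)) \<in> measurable (PiM T M) N"
    by (rule measurable_compose[OF measurable_restrict_subset[OF sub] f])
  moreover have "(\<lambda>x. f (restrict x S)) = f"
    by (intro ext depends_onD[OF dep]) simp
  ultimately show ?thesis by simp
qed

section \<open>Products of functions with disjoint scopes\<close>

text \<open>The inner integral of the norm is a constant multiple of the norm of \<open>f\<close>,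
  which gives joint integrability; the iterated integral then factors.\<close>

lemma (in pair_sigma_finite) has_bochner_integral_pair_mult:
  fixes f :: "'a \<Rightarrow> 'c :: {real_normed_field, banach, second_countable_topology}"
  assumes f: "has_bochner_integral M1 f a" and g: "has_bochner_integral M2 g b"
  shows "has_bochner_integral (M1 \<Otimes>\<^sub>M M2) (\<lambda>p. f (fst p) * g (snd p)) (a * b)"
proof -
  have int: "integrable M1 f" "integrable M2 g"
    and val: "integral\<^sup>L M1 f = a" "integral\<^sup>L M2 g = b"
    using f g by (auto simp: has_bochner_integral_iff)
  note [measurable] = borel_measurable_integrable[OF int(1)] borel_measurable_integrable[OF int(2)]
  have prod: "integrable (M1 \<Otimes>\<^sub>M M2) (\<lambda>p. f (fst p) * g (snd p))"
    using int by (intro Fubini_integrable) (auto simp: norm_mult)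
  show ?thesis
    using integral_fst'[OF prod] prod val by (simp add: has_bochner_integral_iff)
qed

text \<open>For disjoint finite index sets, \<open>merge\<close> carries the pair measure to the
  product over the union. After merging, \<open>f\<close> sees only the first component and
  \<open>g\<close> only the second.\<close>

lemma (in product_sigma_finite) has_bochner_integral_PiM_mult:
  fixes f g :: "('i \<Rightarrow> 'a) \<Rightarrow> 'c :: {real_normed_field, banach, second_countable_topology}"
  assumes f: "has_bochner_integral (PiM S M) f a" and g: "has_bochner_integral (PiM T M) g b"
    and dep: "depends_on S f" "depends_on T g"
    and fin: "finite S" "finite T" and disj: "S \<inter> T = {}"
  shows "has_bochner_integral (PiM (S \<union> T) M) (\<lambda>x. f x * g x) (a * b)"
proof -
  interpret S: finite_product_sigma_finite M S by standard fact
  interpret T: finite_product_sigma_finite M T by standard fact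
  interpret P: pair_sigma_finite "PiM S M" "PiM T M" ..
  have [measurable]: "f \<in> borel_measurable (PiM (S \<union> T) M)" "g \<in> borel_measurable (PiM (S \<union> T) M)"
    using f g dep by (auto intro: measurable_depends_on dest: borel_measurable_has_bochner_integral)
  have eq: "f (merge S T p) = f (fst p)" "g (merge S T p) = g (snd p)" for p
    using disj
    by (auto intro!: depends_onD[OF dep(1)] depends_onD[OF dep(2)] simp: merge_def split: prod.split)
  have "has_bochner_integral (PiM S M \<Otimes>\<^sub>M PiM T M)
          (\<lambda>p. f (merge S T p) * g (merge S T p)) (a * b)"
    unfolding eq by (rule P.has_bochner_integral_pair_mult[OF f g])
  then have "has_bochner_integral
      (distr (PiM S M \<Otimes>\<^sub>M PiM T M) (PiM (S \<union> T) M) (merge S T)) (\<lambda>x. f x * g x) (a * b)"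
    by (intro has_bochner_integral_distr) auto
  then show ?thesis
    by (simp add: distr_merge[OF disj fin])
qed

text \<open>The empty product measure is a point mass. This is the base case for lists of
  factors.\<close>

lemma has_bochner_integral_PiM_empty:
  fixes c :: "'c :: {banach, second_countable_topology}"
  shows "has_bochner_integral (PiM {} M) (\<lambda>_. c) c"
  by (simp add: has_bochner_integral_iff PiM_empty integrable_count_space
      lebesgue_integral_count_space_finite)

text \<open>\<open>sorted_wrt\<close> compares list positions, as \<open>decomposable\<close> does.
  In the induction it makes the scope of the head disjoint from the union of the scopes in the
  tail.\<close>

lemma (in product_sigma_finite) has_bochner_integral_PiM_prod_list:
  fixes f :: "'m \<Rightarrow> ('i \<Rightarrow> 'a) \<Rightarrow> 'c :: {real_normed_field, banach, second_countable_topology}"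
  assumes "\<And>m. m \<in> set ms \<Longrightarrow> has_bochner_integral (PiM (S m) M) (f m) (a m)"
    and "\<And>m. m \<in> set ms \<Longrightarrow> depends_on (S m) (f m)"
    and "\<And>m. m \<in> set ms \<Longrightarrow> finite (S m)"
    and "sorted_wrt (\<lambda>m m'. S m \<inter> S m' = {}) ms"
  shows "has_bochner_integral (PiM (\<Union> (S ` set ms)) M) (\<lambda>x. \<Prod>m\<leftarrow>ms. f m x) (\<Prod>m\<leftarrow>ms. a m)"
  using assms
proof (induction ms)
  case Nil
  then show ?case by (simp add: has_bochner_integral_PiM_empty)
next
  case (Cons m ms)
  have "has_bochner_integral (PiM (S m \<union> \<Union> (S ` set ms)) M)
          (\<lambda>x. f m x * (\<Prod>m\<leftarrow>ms. f m x)) (a m * (\<Prod>m\<leftarrow>ms. a m))"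
  proof (rule has_bochner_integral_PiM_mult)
    show "depends_on (\<Union> (S ` set ms)) (\<lambda>x. \<Prod>m\<leftarrow>ms. f m x)"
      using Cons.prems(2) by (intro depends_on_comp[of _ _ prod_list] depends_on_map) auto
  qed (use Cons in auto)
  then show ?case by simp
qed

section \<open>Orthonormal vectors of functions\<close>

text \<open>Only the products \<open>v\<^sub>i v\<^sub>j\<^sup>*\<close> are required to be integrable: the components themselves need not
  even be measurable.\<close>

definition orthonormal_on ::
  "('i \<Rightarrow> 'a measure) \<Rightarrow> 'i set \<Rightarrow> nat \<Rightarrow> (('i \<Rightarrow> 'a) \<Rightarrow> complex vec) \<Rightarrow> bool" where
  "orthonormal_on M S n v \<longleftrightarrow>
     finite S \<and> depends_on S v \<and> (\<forall>x. dim_vec (v x) = n) \<and>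
     (\<forall>i<n. \<forall>j<n.
        has_bochner_integral (PiM S M) (\<lambda>x. v x $ i * cnj (v x $ j)) (if i = j then 1 else 0))"

context product_sigma_finite
begin

lemma orthonormal_on_input:
  assumes "orthonormal_functions (M X) fs"
  shows "orthonormal_on M {X} (length fs) (\<lambda>x. vec (length fs) (\<lambda>i. (fs ! i) (x X)))"
proof -
  have "has_bochner_integral (PiM {X} M) (\<lambda>x. (fs ! i) (x X) * cnj ((fs ! j) (x X)))
          (if i = j then 1 else 0)"
    if "i < length fs" "j < length fs" for i j
  proof -
    let ?h = "\<lambda>y. (fs ! i) y * cnj ((fs ! j) y)" and ?d = "if i = j then 1 else 0 :: complex"
    have "has_bochner_integral (M X) ?h ?d"
      using assms that by (simp add: orthonormal_functions_def)
    then have h: "integrable (M X) ?h" "integral\<^sup>L (M X) ?h = ?d"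
      by (simp_all only: has_bochner_integral_iff)
    \<comment> \<open>\<open>M X\<close> is the image of the one-factor product measure under
      evaluation at \<open>X\<close>, so integrability transfers from \<open>M X\<close> to
      assignments.\<close>
    then have "integrable (distr (PiM {X} M) (M X) (\<lambda>x. x X)) ?h"
      by (simp only: distr_singleton)
    then have "integrable (PiM {X} M) (\<lambda>x. ?h (x X))"
      by (rule integrable_distr[rotated]) simp
    moreover have "integral\<^sup>L (PiM {X} M) (\<lambda>x. ?h (x X)) = ?d"
      using product_integral_singleton[OF borel_measurable_integrable[OF h(1)]] h(2) by simp
    ultimately show ?thesis
      by (simp only: has_bochner_integral_iff)
  qed
  moreover have "depends_on {X} (\<lambda>x. vec (length fs) (\<lambda>i. (fs ! i) (x X)))"
    by (auto simp: depends_on_def)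
  ultimately show ?thesis
    by (simp add: orthonormal_on_def)
qed

text \<open>Each Gram entry of a Hadamard product is the product of the corresponding Gram entries
  of the factors, so the Gram matrix is an entrywise product of identity matrices.\<close>

lemma orthonormal_on_hadamard_prod:
  assumes ne: "ms \<noteq> []"
    and orth: "\<And>m. m \<in> set ms \<Longrightarrow> orthonormal_on M (S m) n (v m)"
    and disj: "sorted_wrt (\<lambda>m m'. S m \<inter> S m' = {}) ms"
  shows "orthonormal_on M (\<Union> (S ` set ms)) n (\<lambda>x. hadamard_prod (map (\<lambda>m. v m x) ms))"
proof -
  have dim: "dim_vec (hadamard_prod (map (\<lambda>m. v m x) ms)) = n" for x
    using ne orth by (simp add: hadamard_prod_def orthonormal_on_def hd_map)
  have entry: "hadamard_prod (map (\<lambda>m. v m x) ms) $ i = (\<Prod>m\<leftarrow>ms. v m x $ i)" if "i < n" for x i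
    using that dim[of x] by (simp add: hadamard_prod_def o_def)
  have gram: "hadamard_prod (map (\<lambda>m. v m x) ms) $ i * cnj (hadamard_prod (map (\<lambda>m. v m x) ms) $ j)
      = (\<Prod>m\<leftarrow>ms. v m x $ i * cnj (v m x $ j))" if "i < n" "j < n" for x i j
    unfolding entry[OF that(1)] entry[OF that(2)] by (induction ms) (auto simp: mult_ac)
  \<comment> \<open>Nonemptiness matters off the diagonal: an empty product would give 1 there
    instead of 0.\<close>
  have delta: "(\<Prod>m\<leftarrow>ms. if i = j then 1 else 0) = (if i = j then 1 else 0 :: complex)"
    for i j :: nat
    using ne by (simp add: map_replicate_const)
  have "has_bochner_integral (PiM (\<Union> (S ` set ms)) M)
          (\<lambda>x. \<Prod>m\<leftarrow>ms. v m x $ i * cnj (v m x $ j)) (\<Prod>m\<leftarrow>ms. if i = j then 1 else 0)"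
    if "i < n" "j < n" for i j
  proof (rule has_bochner_integral_PiM_prod_list[OF _ _ _ disj])
    fix m assume "m \<in> set ms"
    then have "orthonormal_on M (S m) n (v m)" by (rule orth)
    then show "has_bochner_integral (PiM (S m) M) (\<lambda>x. v m x $ i * cnj (v m x $ j))
        (if i = j then 1 else 0)"
      and "depends_on (S m) (\<lambda>x. v m x $ i * cnj (v m x $ j))" and "finite (S m)"
      using that by (auto simp: orthonormal_on_def intro: depends_on_comp[of _ "v m"])
  qed
  then have "has_bochner_integral (PiM (\<Union> (S ` set ms)) M)
      (\<lambda>x. hadamard_prod (map (\<lambda>m. v m x) ms) $ i * cnj (hadamard_prod (map (\<lambda>m. v m x) ms) $ j))
      (if i = j then 1 else 0)"
    if "i < n" "j < n" for i j
    using that by (simp only: gram delta)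
  moreover have "depends_on (\<Union> (S ` set ms)) (\<lambda>x. hadamard_prod (map (\<lambda>m. v m x) ms))"
    using orth by (intro depends_on_comp[of _ _ hadamard_prod] depends_on_map)
      (auto simp: orthonormal_on_def)
  ultimately show ?thesis
    using dim orth by (auto simp: orthonormal_on_def)
qed

text \<open>An index \<open>i\<close> stands for the pair \<open>(i div q, i mod q)\<close>, so the
  Gram matrix is the Kronecker product of two identity matrices; it is again the identity because
  the pair determines \<open>i\<close>.\<close>

lemma orthonormal_on_kron:
  assumes u: "orthonormal_on M S p u" and v: "orthonormal_on M T q v" and disj: "S \<inter> T = {}"
  shows "orthonormal_on M (S \<union> T) (p * q) (\<lambda>x. kron (u x) (v x))"
proof -
  have dim: "dim_vec (u x) = p" "dim_vec (v x) = q" for x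
    using u v by (auto simp: orthonormal_on_def)
  have "has_bochner_integral (PiM (S \<union> T) M)
      (\<lambda>x. kron (u x) (v x) $ i * cnj (kron (u x) (v x) $ j)) (if i = j then 1 else 0)"
    if ij: "i < p * q" "j < p * q" for i j
  proof -
    let ?f = "\<lambda>x. u x $ (i div q) * cnj (u x $ (j div q))"
      and ?g = "\<lambda>x. v x $ (i mod q) * cnj (v x $ (j mod q))"
    have "q > 0"
      using ij by (cases q) auto
    then have lt: "i div q < p" "j div q < p" "i mod q < q" "j mod q < q"
      using ij by (auto simp: less_mult_imp_div_less)
    have "has_bochner_integral (PiM (S \<union> T) M) (\<lambda>x. ?f x * ?g x)
        ((if i div q = j div q then 1 else 0) * (if i mod q = j mod q then 1 else 0))"
      using u v lt disj
      by (intro has_bochner_integral_PiM_mult)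
        (auto simp: orthonormal_on_def intro: depends_on_comp[of _ u] depends_on_comp[of _ v])
    moreover have "i div q = j div q \<and> i mod q = j mod q \<longleftrightarrow> i = j"
      using div_mult_mod_eq[of i q] div_mult_mod_eq[of j q] by metis
    then have "(if i div q = j div q then 1 else 0) * (if i mod q = j mod q then 1 else 0)
        = (if i = j then 1 else 0 :: complex)"
      by (cases "i div q = j div q"; cases "i mod q = j mod q") simp_all
    moreover have "kron (u x) (v x) $ i * cnj (kron (u x) (v x) $ j) = ?f x * ?g x" for x
      using ij by (simp add: kron_def dim)
    ultimately show ?thesis by simp
  qed
  moreover have "dim_vec (kron (u x) (v x)) = p * q" for x
    by (simp add: kron_def dim)
  ultimately show ?thesis
    using u v by (auto simp: orthonormal_on_def intro: depends_on_comp2)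
qed

text \<open>The fold starts from the constant vector with single entry 1 over the empty scope, whose
  only Gram entry is 1.\<close>

lemma orthonormal_on_kronecker_prod:
  assumes "\<And>m. m \<in> set ms \<Longrightarrow> orthonormal_on M (S m) (n m) (v m)"
    and "sorted_wrt (\<lambda>m m'. S m \<inter> S m' = {}) ms"
  shows "orthonormal_on M (\<Union> (S ` set ms)) (\<Prod>m\<leftarrow>ms. n m)
           (\<lambda>x. kronecker_prod (map (\<lambda>m. v m x) ms))"
  using assms
proof (induction ms)
  case Nil
  then show ?case
    by (simp add: orthonormal_on_def kronecker_prod_def depends_on_def
        has_bochner_integral_PiM_empty)
next
  case (Cons m ms)
  have "orthonormal_on M (S m \<union> \<Union> (S ` set ms)) (n m * (\<Prod>m\<leftarrow>ms. n m))
          (\<lambda>x. kron (v m x) (kronecker_prod (map (\<lambda>m. v m x) ms)))"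
    using Cons by (intro orthonormal_on_kron) auto
  then show ?case by (simp add: kronecker_prod_def)
qed

text \<open>Expanding both components of \<open>W *\<^sub>v v x\<close> leaves only integrands
  \<open>v x $ k * cnj (v x $ l)\<close>. Their integrals are Kronecker deltas, which collapse the
  double sum to an entry of \<open>W * mat_adjoint W\<close>.\<close>

lemma orthonormal_on_mult_mat_vec:
  assumes v: "orthonormal_on M S (dim_col W) v" and W: "semi_unitary W"
  shows "orthonormal_on M S (dim_row W) (\<lambda>x. W *\<^sub>v v x)"
proof -
  let ?n = "dim_col W"
  have dim: "dim_vec (v x) = ?n" for x
    using v by (simp add: orthonormal_on_def)
  have "has_bochner_integral (PiM S M)
      (\<lambda>x. (W *\<^sub>v v x) $ i * cnj ((W *\<^sub>v v x) $ j)) (if i = j then 1 else 0)"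
    if ij: "i < dim_row W" "j < dim_row W" for i j
  proof -
    have gram: "(W *\<^sub>v v x) $ i * cnj ((W *\<^sub>v v x) $ j) =
        (\<Sum>k<?n. \<Sum>l<?n. (v x $ k * cnj (v x $ l)) * (W $$ (i, k) * cnj (W $$ (j, l))))" for x
      using ij by (simp add: scalar_prod_def dim sum_product atLeast0LessThan mult_ac)
    have "has_bochner_integral (PiM S M)
        (\<lambda>x. \<Sum>k<?n. \<Sum>l<?n. (v x $ k * cnj (v x $ l)) * (W $$ (i, k) * cnj (W $$ (j, l))))
        (\<Sum>k<?n. \<Sum>l<?n. (if k = l then 1 else 0) * (W $$ (i, k) * cnj (W $$ (j, l))))"
      using v by (intro has_bochner_integral_sum has_bochner_integral_mult_left)
        (auto simp: orthonormal_on_def)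
    moreover have "(\<Sum>k<?n. \<Sum>l<?n. (if k = l then 1 else 0) * (W $$ (i, k) * cnj (W $$ (j, l))))
        = (W * mat_adjoint W) $$ (i, j)"
      using ij by (simp add: mat_adjoint_def scalar_prod_def atLeast0LessThan mat_of_rows_def
          if_distrib[of "\<lambda>z. z * _"] cong: if_cong)
    moreover have "(W * mat_adjoint W) $$ (i, j) = (if i = j then 1 else 0)"
      using W ij by (simp add: semi_unitary_def)
    ultimately show ?thesis
      by (simp only: gram)
  qed
  then show ?thesis
    using v by (auto simp: orthonormal_on_def intro: depends_on_comp[of _ v])
qed

end

section \<open>Layers of orthonormal circuits\<close>

text \<open>Closure of the graph under inputs discharges membership once, so the induction
  hypothesis applies to every input directly.\<close>

lemma circuit_induct [consumes 2, case_names layer]: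
  assumes "circuit_graph C" "l \<in> layers C"
    and step: "\<And>l. l \<in> layers C \<Longrightarrow> set (inputs_of C l) \<subseteq> layers C \<Longrightarrow>
      (\<And>m. m \<in> set (inputs_of C l) \<Longrightarrow> P m) \<Longrightarrow> P l"
  shows "P l"
  using wf_input_rel[OF assms(1)] assms(2)
proof (induction l rule: wf_induct_rule)
  case (less l)
  have sub: "set (inputs_of C l) \<subseteq> layers C"
    using assms(1) less.prems by (auto simp: circuit_graph_def)
  show ?case
    using less sub by (intro step[of l]) (auto simp: input_rel_def)
qed

lemma decomposable_sorted_wrt:
  assumes "decomposable C" "l \<in> layers C" "is_product (layer_at C l)"
  shows "sorted_wrt (\<lambda>m m'. scope C m \<inter> scope C m' = {}) (inputs_of C l)"
  using assms by (auto simp: decomposable_def sorted_wrt_iff_nth_less)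

text \<open>The premise \<open>input\<close> is restricted to variables in \<open>V\<close> because
  the family \<open>M\<close> used later agrees with the base measures only there;
  \<open>valid_layer\<close> supplies the membership.\<close>

lemma (in product_sigma_finite) orthonormal_on_layer:
  assumes graph: "circuit_graph C"
    and valid: "\<And>l. l \<in> layers C \<Longrightarrow> valid_layer V C (layer_at C l)"
    and dec: "decomposable C"
    and input: "\<And>l X fs. l \<in> layers C \<Longrightarrow> layer_at C l = Input X fs \<Longrightarrow> X \<in> V \<Longrightarrow>
      orthonormal_functions (M X) fs"
    and sum: "\<And>l W m. l \<in> layers C \<Longrightarrow> layer_at C l = Sum W m \<Longrightarrow> semi_unitary W"
    and l: "l \<in> layers C"
  shows "orthonormal_on M (scope C l) (width C l) (\<lambda>x. layer_value C x l)"
  using graph l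
proof (induction l rule: circuit_induct)
  case (layer l)
  note l = layer.hyps(1)
  note unfold = circuit_rec_unfold[OF graph l]
  have scope: "scope C l = scope_step (layer_at C l) (map (scope C) (inputs_of C l))"
    unfolding scope_def by (rule unfold)
  have width: "width C l = width_step (layer_at C l) (map (width C) (inputs_of C l))"
    unfolding width_def by (rule unfold)
  have "layer_value C x l
      = value_step x (layer_at C l) (map (layer_value C x) (inputs_of C l))" for x
    unfolding layer_value_def by (rule unfold)
  then have val: "(\<lambda>x. layer_value C x l)
      = (\<lambda>x. value_step x (layer_at C l) (map (\<lambda>m. layer_value C x m) (inputs_of C l)))"
    by simp
  show ?case
  proof (cases "layer_at C l")
    case (Input X fs)
    then show ?thesis
      using orthonormal_on_input[of X fs] input[OF l Input] valid[OF l]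
      by (simp add: scope width val)
  next
    case (Hadamard ms)
    have ne: "ms \<noteq> []" and eq: "\<forall>m\<in>set ms. \<forall>m'\<in>set ms. width C m = width C m'"
      using valid[OF l] unfolding Hadamard valid_layer.simps by blast+
    have "width C l = width C (hd ms)"
      \<comment> \<open>The width of a Hadamard layer is read off its first input; validity extends
        it to all inputs.\<close>
      using ne by (simp add: Hadamard width hd_map)
    then have same: "width C m = width C l" if "m \<in> set ms" for m
      using eq that ne hd_in_set by metis
    have "orthonormal_on M (scope C m) (width C l) (\<lambda>x. layer_value C x m)"
      if "m \<in> set ms" for m
      using layer.IH[of m] that same[OF that] by (simp add: Hadamard)
    then show ?thesis
      using orthonormal_on_hadamard_prod[OF ne, of "scope C" "width C l" "\<lambda>m x. layer_value C x m"]
        decomposable_sorted_wrt[OF dec l]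
      by (simp add: Hadamard scope val)
  next
    case (Kronecker ms)
    then show ?thesis
      using orthonormal_on_kronecker_prod[of ms "scope C" "width C" "\<lambda>m x. layer_value C x m"]
        decomposable_sorted_wrt[OF dec l] layer.IH
      by (simp add: scope width val)
  next
    case (Sum W m)
    then show ?thesis
      using orthonormal_on_mult_mat_vec[of "scope C m" W "\<lambda>x. layer_value C x m"]
        layer.IH[of m] valid[OF l] sum[OF l Sum]
      by (simp add: scope width val)
  qed
qed

section \<open>Sigma-finiteness of the base measures\<close>

text \<open>The same countable cover works: completion keeps the measurable sets of \<open>M\<close>
  and their measures.\<close>

lemma sigma_finite_completion:
  assumes "sigma_finite_measure M"
  shows "sigma_finite_measure (completion M)"
proof -
  obtain A where A: "countable A" "A \<subseteq> sets M" "\<Union>A = space M"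
    "\<And>a. a \<in> A \<Longrightarrow> emeasure M a \<noteq> \<infinity>"
    using sigma_finite_measure.sigma_finite_countable[OF assms] by blast
  have "emeasure (completion M) a \<noteq> \<infinity>" if "a \<in> A" for a
  proof -
    have "a \<in> sets M"
      using that A(2) by blast
    then show ?thesis
      using A(4)[OF that] by (simp add: emeasure_completion)
  qed
  moreover have "A \<subseteq> sets (completion M)"
    using A(2) by auto
  ultimately show ?thesis
    using A(1,3) by (intro sigma_finite_measure.intro exI[of _ A]) simp
qed

text \<open>\<open>lebesgue_on A\<close> restricts the completion of \<open>lborel\<close> to a
  measurable set, and embedding along the injection \<open>Inl\<close> preserves sigma-finiteness.
  In the discrete case countability of the domain suffices.\<close>

lemma sigma_finite_base_measure:
  assumes "valid_domain D"
  shows "sigma_finite_measure (base_measure D)"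
proof (cases D)
  case (Continuous A)
  then have "sigma_finite_measure (lebesgue_on A)"
    using assms
    by (intro sigma_finite_measure_restrict_space lborel.sigma_finite_measure_axioms
        sigma_finite_completion) auto
  then show ?thesis
    using Continuous by (simp add: sigma_finite_embed_measure)
next
  case (Discrete A)
  then show ?thesis
    using assms by (simp add: sigma_finite_measure_count_space_countable)
qed

theorem proposition1:
  fixes V :: "'x set"
    and dm :: "'x \<Rightarrow> ('e :: euclidean_space, 'd) var_domain"
    and C :: "('l, 'x, 'e + 'd) circuit"
  assumes "finite V"
    and "\<And>X. X \<in> V \<Longrightarrow> valid_domain (dm X)"
    and "tensorized_circuit V C"
    and "structured_decomposable V C"
    and "orthonormal_circuit dm C"
  shows "partition_function V dm C = 1"
proof -
  \<comment> \<open>The locale asks for a \<open>\<sigma>\<close>-finite measure at every index, also outside \<open>V\<close>.\<close>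
  define M where "M X = (if X \<in> V then base_measure (dm X) else count_space {})" for X
  interpret product_sigma_finite M
    using assms(2) by (intro product_sigma_finite.intro)
      (simp add: M_def sigma_finite_base_measure sigma_finite_measure_count_space_countable)
  have "orthonormal_on M (scope C (output_layer C)) (width C (output_layer C))
      (\<lambda>x. layer_value C x (output_layer C))"
    using assms(3-5)
    by (intro orthonormal_on_layer[where V = V])
      (auto simp: tensorized_circuit_def structured_decomposable_def orthonormal_circuit_def M_def)
  then have "orthonormal_on M V 1 (\<lambda>x. layer_value C x (output_layer C))"
    using assms(3) by (simp add: tensorized_circuit_def)
  then have "has_bochner_integral (PiM V M) (\<lambda>x. circuit_fun C x * cnj (circuit_fun C x)) 1"
    by (simp add: orthonormal_on_def circuit_fun_def)
  moreover have "circuit_fun C x * cnj (circuit_fun C x) = complex_of_real (squaring C x)" for x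
    by (simp only: squaring_def complex_norm_square)
  \<comment> \<open>The Gram entry is a complex integral, whereas \<open>partition_function\<close>
    is real; taking real parts bridges the two.\<close>
  ultimately have "has_bochner_integral (PiM V M) (\<lambda>x. Re (complex_of_real (squaring C x))) (Re 1)"
    by (simp only: has_bochner_integral_Re)
  then have "has_bochner_integral (PiM V M) (squaring C) 1"
    by simp
  \<comment> \<open>A product measure depends only on the factors indexed by \<open>V\<close>, so
    the default outside \<open>V\<close> disappears.\<close>
  moreover have "PiM V M = PiM V (\<lambda>X. base_measure (dm X))"
    by (intro PiM_cong) (auto simp: M_def)
  ultimately show ?thesis
    by (simp add: partition_function_def has_bochner_integral_iff)
qed

end
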